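(* Let $(M,g)$ be a Riemannian manifold and let $\bar g=F^{-2}g$ be a metric conformal to $g$ on $M$. Then $$\bar\Delta_\infty u=F^4\Delta_\infty u+F^3|\nabla u|^2 g(\nabla u,\nabla F)$$ for functions $u$ on $M$.
   Context: $\nabla$, $|\cdot|$, $\Delta_\infty$ denote the gradient, norm and $\infty$-Laplacian with respect to $g$, and $\bar\Delta_\infty$ denotes the $\infty$-Laplacian with respect to $\bar g$. The $\infty$-Laplacian of a $C^2$ function $u$ with respect to $g$ is $\Delta_\infty u=\frac12 g(\nabla u,\nabla|\nabla u|^2)$. Here $F$ is a positive smooth function on $M$. *)

theory Defs
  imports "HOL-Analysis.Analysis"
begin

section \<open>Functions of class C^k on open sets\<close>

text \<open>Intended for open sets only: there \<open>differentiable_on\<close> is differentiability at each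
  point, and \<open>frechet_derivative f (at x) v\<close> is the directional derivative of \<open>f\<close> along \<open>v\<close>.\<close>

primrec Ck_on :: "nat \<Rightarrow> ('e::euclidean_space \<Rightarrow> 'f::real_normed_vector) \<Rightarrow> 'e set \<Rightarrow> bool" where
  "Ck_on 0 f S \<longleftrightarrow> continuous_on S f"
| "Ck_on (Suc k) f S \<longleftrightarrow>
     f differentiable_on S \<and> (\<forall>v. Ck_on k (\<lambda>x. frechet_derivative f (at x) v) S)"

definition smooth_on :: "('e::euclidean_space \<Rightarrow> 'f::real_normed_vector) \<Rightarrow> 'e set \<Rightarrow> bool" where
  "smooth_on f S \<longleftrightarrow> (\<forall>k. Ck_on k f S)"

section \<open>Smooth manifolds\<close>

text \<open>A chart is a pair of its domain and its coordinate map; the values of the coordinate map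
  outside the domain are irrelevant. The dimension of the manifold is the dimension of the
  model space \<open>'e\<close>.\<close>

type_synonym ('a, 'e) chart = "'a set \<times> ('a \<Rightarrow> 'e)"

definition chart_inv :: "('a, 'e) chart \<Rightarrow> 'e \<Rightarrow> 'a" where
  "chart_inv c = inv_into (fst c) (snd c)"

definition is_chart :: "'a topology \<Rightarrow> ('a, 'e::euclidean_space) chart \<Rightarrow> bool" where
  "is_chart M c \<longleftrightarrow> openin M (fst c) \<and> open (snd c ` fst c) \<and>
     homeomorphic_map (subtopology M (fst c)) (top_of_set (snd c ` fst c)) (snd c)"

definition transition :: "('a, 'e) chart \<Rightarrow> ('a, 'e) chart \<Rightarrow> 'e \<Rightarrow> 'e" where
  "transition c d = snd d \<circ> chart_inv c"

definition smooth_manifold :: "'a topology \<Rightarrow> ('a, 'e::euclidean_space) chart set \<Rightarrow> bool" where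
  "smooth_manifold M A \<longleftrightarrow> Hausdorff_space M \<and> second_countable M \<and>
     (\<forall>c\<in>A. is_chart M c) \<and> (\<Union>c\<in>A. fst c) = topspace M \<and>
     (\<forall>c\<in>A. \<forall>d\<in>A. smooth_on (transition c d) (snd c ` (fst c \<inter> fst d)))"

definition Ck_function ::
    "nat \<Rightarrow> ('a, 'e::euclidean_space) chart set \<Rightarrow> ('a \<Rightarrow> real) \<Rightarrow> bool" where
  "Ck_function k A u \<longleftrightarrow> (\<forall>c\<in>A. Ck_on k (u \<circ> chart_inv c) (snd c ` fst c))"

definition smooth_function :: "('a, 'e::euclidean_space) chart set \<Rightarrow> ('a \<Rightarrow> real) \<Rightarrow> bool" where
  "smooth_function A u \<longleftrightarrow> (\<forall>k. Ck_function k A u)"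

section \<open>Tangent vectors\<close>

text \<open>A tangent vector at \<open>p\<close> is a family of coordinate vectors, one for each chart around \<open>p\<close>,
  that transforms by the differentials of the transition maps. The value 0 at all other charts
  makes the representation unique. The vector space operations are pointwise.\<close>

type_synonym ('a, 'e) tangent_vector = "('a, 'e) chart \<Rightarrow> 'e"

definition charts_at :: "('a, 'e) chart set \<Rightarrow> 'a \<Rightarrow> ('a, 'e) chart set" where
  "charts_at A p = {c \<in> A. p \<in> fst c}"

definition tangent_space ::
    "('a, 'e::euclidean_space) chart set \<Rightarrow> 'a \<Rightarrow> ('a, 'e) tangent_vector set" where
  "tangent_space A p = {v. (\<forall>c. c \<notin> charts_at A p \<longrightarrow> v c = 0) \<and>
     (\<forall>c\<in>charts_at A p. \<forall>d\<in>charts_at A p.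
        v d = frechet_derivative (transition c d) (at (snd c p)) (v c))}"

text \<open>The tangent vector at \<open>p\<close> whose coordinate vector in the chart \<open>c\<close> is \<open>a\<close>. For fixed \<open>a\<close>
  these form a constant-coefficient combination of the coordinate fields of \<open>c\<close>.\<close>

definition coord_vector ::
    "('a, 'e::euclidean_space) chart set \<Rightarrow> ('a, 'e) chart \<Rightarrow> 'e \<Rightarrow> 'a \<Rightarrow> ('a, 'e) tangent_vector"
  where
  "coord_vector A c a p = (\<lambda>d. if d \<in> charts_at A p
     then frechet_derivative (transition c d) (at (snd c p)) a else 0)"

text \<open>For differentiable \<open>u\<close> the chart used to compute the differential is immaterial,
  by the chain rule.\<close>

definition differential ::
    "('a, 'e::euclidean_space) chart set \<Rightarrow> ('a \<Rightarrow> real) \<Rightarrow> 'a \<Rightarrow> ('a, 'e) tangent_vector \<Rightarrow> real"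
  where
  "differential A u p v = (let c = (SOME c. c \<in> charts_at A p)
     in frechet_derivative (u \<circ> chart_inv c) (at (snd c p)) (v c))"

section \<open>Riemannian metrics\<close>

type_synonym ('a, 'e) metric_tensor =
  "'a \<Rightarrow> ('a, 'e) tangent_vector \<Rightarrow> ('a, 'e) tangent_vector \<Rightarrow> real"

definition inner_product_at ::
    "('a, 'e::euclidean_space) chart set \<Rightarrow> ('a, 'e) metric_tensor \<Rightarrow> 'a \<Rightarrow> bool" where
  "inner_product_at A g p \<longleftrightarrow>
     (\<forall>v\<in>tangent_space A p. \<forall>w\<in>tangent_space A p. g p v w = g p w v) \<and>
     (\<forall>v\<in>tangent_space A p. \<forall>v'\<in>tangent_space A p. \<forall>w\<in>tangent_space A p. \<forall>s t.
        g p (\<lambda>c. s *\<^sub>R v c + t *\<^sub>R v' c) w = s * g p v w + t * g p v' w) \<and>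
     (\<forall>v\<in>tangent_space A p. v \<noteq> (\<lambda>c. 0) \<longrightarrow> g p v v > 0)"

definition riemannian_manifold ::
    "'a topology \<Rightarrow> ('a, 'e::euclidean_space) chart set \<Rightarrow> ('a, 'e) metric_tensor \<Rightarrow> bool" where
  "riemannian_manifold M A g \<longleftrightarrow> smooth_manifold M A \<and>
     (\<forall>p\<in>topspace M. inner_product_at A g p) \<and>
     (\<forall>c\<in>A. \<forall>a b. smooth_on
        (\<lambda>x. g (chart_inv c x) (coord_vector A c a (chart_inv c x)) (coord_vector A c b (chart_inv c x)))
        (snd c ` fst c))"

definition metric_norm ::
    "('a, 'e) metric_tensor \<Rightarrow> 'a \<Rightarrow> ('a, 'e) tangent_vector \<Rightarrow> real" where
  "metric_norm g p v = sqrt (g p v v)"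

definition grad ::
    "('a, 'e::euclidean_space) chart set \<Rightarrow> ('a, 'e) metric_tensor \<Rightarrow> ('a \<Rightarrow> real) \<Rightarrow> 'a
       \<Rightarrow> ('a, 'e) tangent_vector" where
  "grad A g u p = (THE v. v \<in> tangent_space A p \<and>
     (\<forall>w\<in>tangent_space A p. g p v w = differential A u p w))"

definition infinity_laplacian ::
    "('a, 'e::euclidean_space) chart set \<Rightarrow> ('a, 'e) metric_tensor \<Rightarrow> ('a \<Rightarrow> real) \<Rightarrow> 'a \<Rightarrow> real"
  where
  "infinity_laplacian A g u p =
     1 / 2 * g p (grad A g u p) (grad A g (\<lambda>q. (metric_norm g q (grad A g u q))\<^sup>2) p)"

definition conformal_metric ::
    "('a \<Rightarrow> real) \<Rightarrow> ('a, 'e) metric_tensor \<Rightarrow> ('a, 'e) metric_tensor" where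
  "conformal_metric F g = (\<lambda>p v w. F p powi (-2) * g p v w)"

end

theory Submission
  imports Defs
begin

text \<open>
  Write \<open>h = |\<nabla>u|\<^sup>2\<close>. By symmetry of the metric, the infinity Laplacian of \<open>u\<close> is
  \<open>1/2 dh(\<nabla>u)\<close>. For the metric \<open>F\<^sup>-\<^sup>2 g\<close>, uniqueness of the vector that represents \<open>du\<close>
  shows that the gradient of \<open>u\<close> is \<open>F\<^sup>2 \<nabla>u\<close>, and hence its squared norm is \<open>F\<^sup>2 h\<close>. The new
  infinity Laplacian is therefore \<open>1/2 d(F\<^sup>2 h)(F\<^sup>2 \<nabla>u)\<close>, and the product rule
  \<open>d(F\<^sup>2 h) = F\<^sup>2 dh + 2 F h dF\<close> together with \<open>dF(\<nabla>u) = g(\<nabla>u, \<nabla>F)\<close> gives the claim.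

  The computation needs two facts. The gradient exists as a tangent vector and represents the
  differential at every point (\<open>grad_properties\<close>); this is the Riesz representation in
  coordinates, plus the independence of the differential from the chart
  (\<open>differential_in_chart\<close>). The product rule needs \<open>h\<close> to be differentiable at the point
  (\<open>grad_norm_square_differentiable\<close>). In coordinates \<open>h(x)\<close> is the squared norm of the covector
  \<open>du\<close> for the inner product dual to \<open>g\<close>, and \<open>dual_norm_differentiable\<close> derives its
  differentiability from that of the coefficients of \<open>g\<close> and of \<open>du\<close> without inverting the matrix
  of \<open>g\<close>: that squared norm is the maximum over \<open>w\<close> of \<open>2 du(w) - g(w, w)\<close>, and near a given
  point the maximum differs from the value at the maximizer of that point by a term of second
  order only.
\<close>

section \<open>Families of inner products on a Euclidean space\<close>

lemma inner_product_riesz: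
  fixes G :: "'e::euclidean_space \<Rightarrow> 'e \<Rightarrow> real"
  assumes "bilinear G" and pos: "\<And>a. a \<noteq> 0 \<Longrightarrow> G a a > 0" and "linear \<phi>"
  obtains w where "\<And>b. G w b = \<phi> b"
proof -
  define L where "L a = (\<Sum>i\<in>Basis. G a i *\<^sub>R i)" for a
  have linG: "linear (G a)" and linG': "linear (\<lambda>a. G a b)" for a b
    using \<open>bilinear G\<close> by (auto simp: bilinear_def)
  have linL: "linear L"
    by (rule linearI)
       (simp_all add: L_def linear_add[OF linG'] linear_scale[OF linG'] scaleR_add_left
          sum.distrib scaleR_right.sum)
  have L_inner: "L a \<bullet> b = G a b" for a b
  proof -
    have "L a \<bullet> b = (\<Sum>i\<in>Basis. (b \<bullet> i) * G a i)"
      unfolding L_def inner_sum_left by (simp add: inner_commute[of _ b] mult.commute)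
    also have "\<dots> = G a (\<Sum>i\<in>Basis. (b \<bullet> i) *\<^sub>R i)"
      by (simp add: linear_sum[OF linG] linear_scale[OF linG])
    finally show ?thesis by (simp add: euclidean_representation)
  qed
  have "inj L"
  proof (rule injI)
    fix a b assume "L a = L b"
    hence "L (a - b) = 0" by (simp add: linear_diff[OF linL])
    hence "G (a - b) (a - b) = 0" by (metis L_inner inner_zero_left)
    thus "a = b" using pos[of "a - b"] by auto
  qed
  hence "surj L" using linL by (simp add: linear_injective_imp_surjective)
  then obtain w where w: "L w = (\<Sum>i\<in>Basis. \<phi> i *\<^sub>R i)" by (metis surjD)
  have "G w b = \<phi> b" for b
  proof -
    have "G w b = (\<Sum>i\<in>Basis. (b \<bullet> i) * \<phi> i)"
      unfolding L_inner[symmetric] w inner_sum_left by (simp add: inner_commute[of _ b] mult.commute)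
    also have "\<dots> = \<phi> (\<Sum>i\<in>Basis. (b \<bullet> i) *\<^sub>R i)"
      by (simp add: linear_sum[OF \<open>linear \<phi>\<close>] linear_scale[OF \<open>linear \<phi>\<close>])
    finally show ?thesis by (simp add: euclidean_representation)
  qed
  thus thesis by (rule that)
qed

lemma bilinear_quadratic_bound:
  fixes H :: "'e::euclidean_space \<Rightarrow> 'e \<Rightarrow> real"
  assumes "bilinear H"
  shows "\<bar>H v v\<bar> \<le> (\<Sum>i\<in>Basis. \<Sum>j\<in>Basis. \<bar>H i j\<bar>) * (norm v)\<^sup>2"
proof -
  have "H v v = H (\<Sum>i\<in>Basis. (v \<bullet> i) *\<^sub>R i) (\<Sum>i\<in>Basis. (v \<bullet> i) *\<^sub>R i)"
    by (simp add: euclidean_representation)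
  also have "\<dots> = (\<Sum>i\<in>Basis. \<Sum>j\<in>Basis. (v \<bullet> i) * ((v \<bullet> j) * H i j))"
    using assms by (simp add: bilinear_sum sum.cartesian_product bilinear_lmul bilinear_rmul)
  finally have "\<bar>H v v\<bar> \<le> (\<Sum>i\<in>Basis. \<Sum>j\<in>Basis. \<bar>(v \<bullet> i) * ((v \<bullet> j) * H i j)\<bar>)"
    by (simp add: order_trans[OF sum_abs] sum_mono)
  also have "\<dots> \<le> (\<Sum>i\<in>Basis. \<Sum>j\<in>Basis. norm v * (norm v * \<bar>H i j\<bar>))"
    by (intro sum_mono) (auto simp: abs_mult Basis_le_norm intro!: mult_mono)
  also have "\<dots> = (\<Sum>i\<in>Basis. \<Sum>j\<in>Basis. \<bar>H i j\<bar>) * (norm v)\<^sup>2"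
    by (simp add: sum_distrib_right sum_distrib_left power2_eq_square mult_ac)
  finally show ?thesis .
qed

lemma inner_product_coercive:
  fixes G :: "'e::euclidean_space \<Rightarrow> 'e \<Rightarrow> real"
  assumes "bilinear G" and pos: "\<And>a. a \<noteq> 0 \<Longrightarrow> G a a > 0"
  obtains m where "m > 0" and "\<And>v. m * (norm v)\<^sup>2 \<le> G v v"
proof -
  have "sphere (0::'e) 1 \<noteq> {}" by simp
  moreover have "continuous_on (sphere 0 1) (\<lambda>v. G v v)"
    using bilinear_continuous_on_compose[OF continuous_on_id continuous_on_id \<open>bilinear G\<close>] .
  ultimately obtain z where z: "z \<in> sphere 0 1" and min: "\<And>y. y \<in> sphere 0 1 \<Longrightarrow> G z z \<le> G y y"
    using continuous_attains_inf[OF compact_sphere] by blast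
  have "G z z * (norm v)\<^sup>2 \<le> G v v" for v
  proof (cases "v = 0")
    case True
    thus ?thesis using \<open>bilinear G\<close> by (simp add: bilinear_lzero)
  next
    case False
    have "G z z * (norm v)\<^sup>2 \<le> G ((1 / norm v) *\<^sub>R v) ((1 / norm v) *\<^sub>R v) * (norm v)\<^sup>2"
      using False by (intro mult_right_mono min) auto
    also have "\<dots> = G v v"
      using False \<open>bilinear G\<close> by (simp add: bilinear_lmul bilinear_rmul power2_eq_square)
    finally show ?thesis .
  qed
  moreover have "G z z > 0" using z by (intro pos) auto
  ultimately show thesis using that by blast
qed

text \<open>If \<open>G x0\<close> is positive definite and the coefficients of \<open>G\<close> are continuous at \<open>x0\<close>, then
  one coercivity constant serves for all points near \<open>x0\<close>.\<close>

lemma inner_products_coercive_nearby: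
  fixes G :: "'x::metric_space \<Rightarrow> 'e::euclidean_space \<Rightarrow> 'e \<Rightarrow> real"
  assumes "open U" and "x0 \<in> U" and bil: "\<And>x. x \<in> U \<Longrightarrow> bilinear (G x)"
    and pos: "\<And>a. a \<noteq> 0 \<Longrightarrow> G x0 a a > 0"
    and cont: "\<And>a b. isCont (\<lambda>x. G x a b) x0"
  obtains m where "m > 0" and "\<forall>\<^sub>F x in nhds x0. \<forall>v. m * (norm v)\<^sup>2 \<le> G x v v"
proof -
  obtain m where m: "m > 0" "\<And>v. m * (norm v)\<^sup>2 \<le> G x0 v v"
    using inner_product_coercive[OF bil[OF \<open>x0 \<in> U\<close>] pos] by blast
  define e where "e x = (\<Sum>i\<in>Basis. \<Sum>j\<in>Basis. \<bar>G x i j - G x0 i j\<bar>)" for x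
  have "isCont e x0"
    unfolding e_def by (intro continuous_intros cont)
  hence "(e \<longlongrightarrow> e x0) (nhds x0)"
    unfolding continuous_within tendsto_at_iff_tendsto_nhds .
  moreover have "e x0 < m / 2" using m(1) by (simp add: e_def)
  ultimately have "\<forall>\<^sub>F x in nhds x0. e x < m / 2"
    by (rule order_tendstoD(2))
  moreover have "\<forall>\<^sub>F x in nhds x0. x \<in> U"
    using \<open>open U\<close> \<open>x0 \<in> U\<close> by (rule eventually_nhds_in_open)
  ultimately have "\<forall>\<^sub>F x in nhds x0. \<forall>v. m / 2 * (norm v)\<^sup>2 \<le> G x v v"
  proof eventually_elim
    case (elim x)
    show ?case
    proof
      fix v
      have "bilinear (\<lambda>a b. G x a b - G x0 a b)"
        using bil[OF \<open>x \<in> U\<close>] bil[OF \<open>x0 \<in> U\<close>] unfolding bilinear_def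
        by (auto intro!: linear_compose_sub)
      from bilinear_quadratic_bound[OF this, of v]
      have "\<bar>G x v v - G x0 v v\<bar> \<le> e x * (norm v)\<^sup>2" by (simp add: e_def)
      also have "\<dots> \<le> m / 2 * (norm v)\<^sup>2" using elim by (intro mult_right_mono) auto
      finally show "m / 2 * (norm v)\<^sup>2 \<le> G x v v" using m(2)[of v] by linarith
    qed
  qed
  thus thesis using that[of "m / 2"] m(1) by simp
qed

lemma has_derivative_zero_squeeze:
  fixes N S :: "'x::real_normed_vector \<Rightarrow> real"
  assumes "\<forall>\<^sub>F x in nhds x0. 0 \<le> N x \<and> N x \<le> S x" and "S x0 = 0"
    and "(S has_derivative (\<lambda>_. 0)) (at x0)"
  shows "(N has_derivative (\<lambda>_. 0)) (at x0)"
proof -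
  have N0: "N x0 = 0" using eventually_nhds_x_imp_x[OF assms(1)] \<open>S x0 = 0\<close> by linarith
  have lim: "((\<lambda>y. norm (S y - S x0 - 0) / norm (y - x0)) \<longlongrightarrow> 0) (at x0)"
    using assms(3) unfolding has_derivative_iff_norm by blast
  have "\<forall>\<^sub>F y in at x0. 0 \<le> N y \<and> N y \<le> S y"
    using assms(1) by (simp add: eventually_at_filter eventually_mono)
  hence "\<forall>\<^sub>F y in at x0. norm (norm (N y - N x0 - 0) / norm (y - x0))
      \<le> norm (S y - S x0 - 0) / norm (y - x0)"
    by eventually_elim (auto simp: N0 \<open>S x0 = 0\<close> intro!: divide_right_mono)
  hence "((\<lambda>y. norm (N y - N x0 - 0) / norm (y - x0)) \<longlongrightarrow> 0) (at x0)"
    using lim by (rule Lim_null_comparison)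
  thus ?thesis unfolding has_derivative_iff_norm by simp
qed

text \<open>The squared norm of a covector \<open>\<phi> x\<close> for the inner product dual to \<open>G x\<close>, where \<open>w x\<close> is the
  vector that represents \<open>\<phi> x\<close>, depends differentiably on \<open>x\<close>. With \<open>w0 = w x0\<close>, completing the
  square shows that it exceeds the differentiable function \<open>2 \<phi> x w0 - G x w0 w0\<close> by
  \<open>N x = G x (w x - w0) (w x - w0)\<close>. The functional \<open>\<delta> x = G x (w x - w0)\<close> has differentiable
  components that vanish at \<open>x0\<close>, and by coercivity \<open>N x\<close> is at most a constant times the
  square of the norm of \<open>\<delta> x\<close>. So \<open>N\<close> has derivative zero at \<open>x0\<close>. No regularity of \<open>w\<close> is
  assumed.\<close>

lemma dual_norm_differentiable:
  fixes G :: "'x::real_normed_vector \<Rightarrow> 'e::euclidean_space \<Rightarrow> 'e \<Rightarrow> real"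
  assumes "open U" and "x0 \<in> U" and bil: "\<And>x. x \<in> U \<Longrightarrow> bilinear (G x)"
    and sym: "\<And>x a b. x \<in> U \<Longrightarrow> G x a b = G x b a"
    and pos: "\<And>a. a \<noteq> 0 \<Longrightarrow> G x0 a a > 0"
    and Gd: "\<And>a b. (\<lambda>x. G x a b) differentiable (at x0)"
    and \<phi>d: "\<And>b. (\<lambda>x. \<phi> x b) differentiable (at x0)"
    and w: "\<And>x b. x \<in> U \<Longrightarrow> G x (w x) b = \<phi> x b"
  shows "(\<lambda>x. G x (w x) (w x)) differentiable (at x0)"
proof -
  define w0 where "w0 = w x0"
  define \<delta> where "\<delta> b x = \<phi> x b - G x w0 b" for b x
  define S where "S x = (\<Sum>i\<in>Basis. (\<delta> i x)\<^sup>2)" for x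
  define N where "N x = G x (w x) (w x) - (2 * \<phi> x w0 - G x w0 w0)" for x
  have \<delta>: "\<delta> b x = G x (w x - w0) b" if "x \<in> U" for x b
    using that by (simp add: \<delta>_def w[symmetric] bilinear_lsub[OF bil])
  have N: "N x = G x (w x - w0) (w x - w0)" if "x \<in> U" for x
    using that sym[OF that, of w0 "w x"]
    by (simp add: N_def w[symmetric] bilinear_lsub[OF bil] bilinear_rsub[OF bil])
  have \<delta>0: "\<delta> b x0 = 0" for b
    using \<open>x0 \<in> U\<close> by (simp add: \<delta>_def w0_def w)
  have "(S has_derivative (\<lambda>_. 0)) (at x0)"
  proof -
    have "((\<lambda>x. (\<delta> i x)\<^sup>2) has_derivative (\<lambda>_. 0)) (at x0)" for i
    proof -
      have "(\<lambda>x. \<delta> i x) differentiable (at x0)"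
        unfolding \<delta>_def by (rule differentiable_diff[OF \<phi>d Gd])
      then obtain D where "(\<delta> i has_derivative D) (at x0)" by (auto simp: differentiable_def)
      from has_derivative_mult[OF this this] show ?thesis
        by (simp add: \<delta>0 power2_eq_square)
    qed
    hence "(S has_derivative (\<lambda>_. \<Sum>i\<in>(Basis::'e set). 0)) (at x0)"
      unfolding S_def by (intro has_derivative_sum)
    thus ?thesis by simp
  qed
  obtain m where m: "m > 0" "\<forall>\<^sub>F x in nhds x0. \<forall>v. m * (norm v)\<^sup>2 \<le> G x v v"
    using inner_products_coercive_nearby[OF \<open>open U\<close> \<open>x0 \<in> U\<close> bil pos
        differentiable_imp_continuous_within[OF Gd]] by blast
  have "\<forall>\<^sub>F x in nhds x0. x \<in> U"
    using \<open>open U\<close> \<open>x0 \<in> U\<close> by (rule eventually_nhds_in_open)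
  with m(2) have "\<forall>\<^sub>F x in nhds x0. 0 \<le> N x \<and> N x \<le> S x / m"
  proof eventually_elim
    case (elim x)
    define v where "v = w x - w0"
    \<comment> \<open>the vector that represents \<open>\<delta>\<close> in the Euclidean inner product\<close>
    define d where "d = (\<Sum>i\<in>Basis. \<delta> i x *\<^sub>R i)"
    have Nv: "N x = G x v v" using N[OF \<open>x \<in> U\<close>] by (simp add: v_def)
    have coer: "m * (norm v)\<^sup>2 \<le> N x" using elim Nv by simp
    have "0 \<le> m * (norm v)\<^sup>2" using m(1) by simp
    with coer have N_ge: "0 \<le> N x" by linarith
    have "d \<bullet> v = (\<Sum>i\<in>Basis. (v \<bullet> i) * G x v i)"
      unfolding d_def inner_sum_left \<delta>[OF \<open>x \<in> U\<close>] v_def[symmetric]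
      by (simp add: inner_commute[of _ v] mult.commute)
    also have "\<dots> = G x v (\<Sum>i\<in>Basis. (v \<bullet> i) *\<^sub>R i)"
      using bil[OF \<open>x \<in> U\<close>] by (simp add: bilinear_def linear_sum linear_scale)
    finally have Nd: "N x = d \<bullet> v" by (simp add: euclidean_representation Nv)
    have Sd: "S x = (norm d)\<^sup>2"
      unfolding S_def power2_norm_eq_inner
      by (subst euclidean_inner) (simp add: d_def power2_eq_square)
    have "(N x)\<^sup>2 \<le> (norm d)\<^sup>2 * (norm v)\<^sup>2"
      unfolding Nd power2_norm_eq_inner by (rule Cauchy_Schwarz_ineq)
    hence "m * (N x)\<^sup>2 \<le> (norm d)\<^sup>2 * (m * (norm v)\<^sup>2)"
      using m(1) by (simp add: mult.left_commute)
    also have "\<dots> \<le> (norm d)\<^sup>2 * N x" using coer by (intro mult_left_mono) auto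
    finally have "N x * (m * N x) \<le> N x * S x"
      by (simp add: Sd power2_eq_square mult_ac)
    moreover have "0 \<le> S x" by (simp add: Sd)
    ultimately have "m * N x \<le> S x" using N_ge
      by (cases "N x = 0") auto
    thus ?case using N_ge m(1) by (simp add: pos_le_divide_eq mult.commute)
  qed
  moreover have "S x0 / m = 0" by (simp add: S_def \<delta>0)
  moreover have "((\<lambda>x. S x / m) has_derivative (\<lambda>_. 0)) (at x0)"
    using bounded_linear.has_derivative[OF bounded_linear_divide
      \<open>(S has_derivative (\<lambda>_. 0)) (at x0)\<close>, of m] by simp
  ultimately have "(N has_derivative (\<lambda>_. 0)) (at x0)"
    by (rule has_derivative_zero_squeeze)
  hence "N differentiable (at x0)" by (rule differentiableI)
  moreover have "(\<lambda>x. 2 * \<phi> x w0 - G x w0 w0) differentiable (at x0)"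
    by (rule differentiable_diff[OF differentiable_mult[OF differentiable_const \<phi>d] Gd])
  ultimately have "(\<lambda>x. N x + (2 * \<phi> x w0 - G x w0 w0)) differentiable (at x0)"
    by (rule differentiable_add)
  thus ?thesis by (simp add: N_def)
qed

section \<open>Change of charts\<close>

lemma smooth_manifold_is_chart:
  "smooth_manifold M A \<Longrightarrow> c \<in> A \<Longrightarrow> is_chart M c"
  by (simp add: smooth_manifold_def)

lemma chart_inv_chart:
  assumes "smooth_manifold M A" and "c \<in> A" and "p \<in> fst c"
  shows "chart_inv c (snd c p) = p"
proof -
  have c: "is_chart M c" using assms smooth_manifold_is_chart by blast
  hence "fst c \<subseteq> topspace M" by (auto simp: is_chart_def openin_subset)
  hence "inj_on (snd c) (fst c)"
    using c homeomorphic_imp_injective_map[of "subtopology M (fst c)"]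
    by (force simp: is_chart_def topspace_subtopology Int_absorb1)
  thus ?thesis using assms by (simp add: chart_inv_def)
qed

lemma open_chart_image:
  assumes "smooth_manifold M A" and "c \<in> A" and "d \<in> A"
  shows "open (snd c ` (fst c \<inter> fst d))"
proof -
  have c: "is_chart M c" and d: "is_chart M d"
    using assms smooth_manifold_is_chart by blast+
  have "open_map (subtopology M (fst c)) (top_of_set (snd c ` fst c)) (snd c)"
    using c by (auto simp: is_chart_def intro: homeomorphic_imp_open_map)
  moreover have "openin (subtopology M (fst c)) (fst c \<inter> fst d)"
    using d by (auto simp: is_chart_def intro: openin_subtopology_Int2)
  ultimately have "openin (top_of_set (snd c ` fst c)) (snd c ` (fst c \<inter> fst d))"
    by (auto simp: open_map_def)
  thus ?thesis using c by (auto simp: is_chart_def openin_open_eq)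
qed

lemma open_chart_range:
  assumes "smooth_manifold M A" and "c \<in> A"
  shows "open (snd c ` fst c)"
  using open_chart_image[OF assms(1,2,2)] by simp

lemma Ck_on_Suc_differentiable_at:
  assumes "Ck_on (Suc k) f S" and "open S" and "x \<in> S"
  shows "f differentiable (at x)"
  using assms by (auto simp: differentiable_on_eq_differentiable_at)

lemma smooth_on_differentiable_at:
  assumes "smooth_on f S" and "open S" and "x \<in> S"
  shows "f differentiable (at x)"
  using assms Ck_on_Suc_differentiable_at unfolding smooth_on_def by blast

lemma transition_differentiable:
  assumes "smooth_manifold M A" and "c \<in> A" and "d \<in> A" and "p \<in> fst c \<inter> fst d"
  shows "transition c d differentiable (at (snd c p))"
proof (rule smooth_on_differentiable_at)
  show "smooth_on (transition c d) (snd c ` (fst c \<inter> fst d))"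
    using assms by (simp add: smooth_manifold_def)
qed (use assms open_chart_image in blast)+

text \<open>The chain rule for a change of charts. With \<open>h\<close> the coordinate map of a third chart it is
  the cocycle identity of the differentials of the transition maps.\<close>

lemma frechet_derivative_change_chart:
  fixes h :: "'a \<Rightarrow> 'b::real_normed_vector"
  assumes M: "smooth_manifold M A" and c: "c \<in> A" and d: "d \<in> A" and p: "p \<in> fst c \<inter> fst d"
    and h: "(h \<circ> chart_inv d) differentiable (at (snd d p))"
  shows "frechet_derivative (h \<circ> chart_inv c) (at (snd c p)) a =
    frechet_derivative (h \<circ> chart_inv d) (at (snd d p))
      (frechet_derivative (transition c d) (at (snd c p)) a)"
proof -
  have t: "transition c d (snd c q) = snd d q" if "q \<in> fst c" for q
    using that chart_inv_chart[OF M c] by (simp add: transition_def)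
  have "(transition c d has_derivative frechet_derivative (transition c d) (at (snd c p)))
      (at (snd c p))"
    using transition_differentiable[OF M c d p] by (simp add: frechet_derivative_works)
  moreover have "((h \<circ> chart_inv d) has_derivative
      frechet_derivative (h \<circ> chart_inv d) (at (snd d p))) (at (transition c d (snd c p)))"
    using h p by (simp add: frechet_derivative_works t)
  ultimately have "((h \<circ> chart_inv d) \<circ> transition c d has_derivative
      frechet_derivative (h \<circ> chart_inv d) (at (snd d p)) \<circ>
      frechet_derivative (transition c d) (at (snd c p))) (at (snd c p))"
    by (rule diff_chain_at)
  hence "((h \<circ> chart_inv c) has_derivative
      frechet_derivative (h \<circ> chart_inv d) (at (snd d p)) \<circ>
      frechet_derivative (transition c d) (at (snd c p))) (at (snd c p))"
  proof (rule has_derivative_transform_within_open[OF _ open_chart_image[OF M c d]])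
    show "snd c p \<in> snd c ` (fst c \<inter> fst d)" using p by blast
    fix x assume "x \<in> snd c ` (fst c \<inter> fst d)"
    then obtain q where q: "q \<in> fst c \<inter> fst d" "x = snd c q" by blast
    thus "((h \<circ> chart_inv d) \<circ> transition c d) x = (h \<circ> chart_inv c) x"
      by (simp add: t chart_inv_chart[OF M c] chart_inv_chart[OF M d])
  qed
  from frechet_derivative_at[OF this] show ?thesis
    by (simp add: fun_eq_iff)
qed

lemma frechet_derivative_transition_self:
  assumes M: "smooth_manifold M A" and c: "c \<in> A" and p: "p \<in> fst c"
  shows "frechet_derivative (transition c c) (at (snd c p)) a = a"
proof -
  have "(transition c c has_derivative (\<lambda>x. x)) (at (snd c p))"
  proof (rule has_derivative_transform_within_open[OF has_derivative_ident open_chart_range[OF M c]])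
    show "snd c p \<in> snd c ` fst c" using p by blast
    fix x assume "x \<in> snd c ` fst c"
    thus "x = transition c c x"
      by (auto simp: transition_def chart_inv_chart[OF M c])
  qed
  from frechet_derivative_at[OF this] show ?thesis by metis
qed

section \<open>Tangent vectors in a chart\<close>

lemma charts_at_nonempty:
  assumes "smooth_manifold M A" and "p \<in> topspace M"
  shows "\<exists>c. c \<in> charts_at A p"
proof -
  have "p \<in> (\<Union>c\<in>A. fst c)" using assms unfolding smooth_manifold_def by blast
  thus ?thesis unfolding charts_at_def by blast
qed

lemma coord_vector_self:
  assumes "smooth_manifold M A" and "c \<in> charts_at A p"
  shows "coord_vector A c a p c = a"
  using frechet_derivative_transition_self[OF assms(1), of c p a] assms(2)
  by (simp add: coord_vector_def charts_at_def)

lemma coord_vector_in_tangent_space: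
  assumes M: "smooth_manifold M A" and "c \<in> charts_at A p"
  shows "coord_vector A c a p \<in> tangent_space A p"
proof -
  have "frechet_derivative (transition c e) (at (snd c p)) a =
      frechet_derivative (transition d e) (at (snd d p))
        (frechet_derivative (transition c d) (at (snd c p)) a)"
    if "d \<in> charts_at A p" "e \<in> charts_at A p" for d e
    \<comment> \<open>a transition map to \<open>e\<close> is the coordinate map of \<open>e\<close> read in the source chart\<close>
    unfolding transition_def[of c e] transition_def[of d e]
    using that assms transition_differentiable[OF M, of d e p]
    by (intro frechet_derivative_change_chart[OF M]) (auto simp: charts_at_def transition_def)
  note cocycle = this
  show ?thesis
    unfolding tangent_space_def
  proof (intro CollectI conjI allI impI ballI)
    fix d e assume "d \<in> charts_at A p" "e \<in> charts_at A p"
    with cocycle[OF this] show "coord_vector A c a p e =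
        frechet_derivative (transition d e) (at (snd d p)) (coord_vector A c a p d)"
      unfolding coord_vector_def by (simp only: if_True)
  qed (simp add: coord_vector_def)
qed

lemma tangent_vector_eq_coord_vector:
  assumes "c \<in> charts_at A p" and "v \<in> tangent_space A p"
  shows "v = coord_vector A c (v c) p"
proof
  fix d
  show "v d = coord_vector A c (v c) p d"
  proof (cases "d \<in> charts_at A p")
    case True
    hence "v d = frechet_derivative (transition c d) (at (snd c p)) (v c)"
      using assms unfolding tangent_space_def by blast
    thus ?thesis using True unfolding coord_vector_def by (simp only: if_True)
  next
    case False
    thus ?thesis using assms(2) unfolding tangent_space_def coord_vector_def
      by (simp only: if_False) blast
  qed
qed

lemma coord_vector_lincomb:
  assumes M: "smooth_manifold M A" and "c \<in> charts_at A p"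
  shows "coord_vector A c (s *\<^sub>R a + t *\<^sub>R b) p =
    (\<lambda>d. s *\<^sub>R coord_vector A c a p d + t *\<^sub>R coord_vector A c b p d)"
proof
  fix d
  show "coord_vector A c (s *\<^sub>R a + t *\<^sub>R b) p d =
      s *\<^sub>R coord_vector A c a p d + t *\<^sub>R coord_vector A c b p d"
  proof (cases "d \<in> charts_at A p")
    case True
    have "linear (frechet_derivative (transition c d) (at (snd c p)))"
      using True assms
      by (intro linear_frechet_derivative transition_differentiable[OF M]) (auto simp: charts_at_def)
    thus ?thesis using True by (simp add: coord_vector_def linear_add linear_scale)
  qed (simp add: coord_vector_def)
qed

lemma tangent_space_lincomb:
  assumes M: "smooth_manifold M A" and p: "p \<in> topspace M"
    and v: "v \<in> tangent_space A p" and w: "w \<in> tangent_space A p"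
  shows "(\<lambda>d. s *\<^sub>R v d + t *\<^sub>R w d) \<in> tangent_space A p"
proof -
  obtain c where c: "c \<in> charts_at A p" using charts_at_nonempty[OF M p] by blast
  have "coord_vector A c (s *\<^sub>R v c + t *\<^sub>R w c) p = (\<lambda>d. s *\<^sub>R v d + t *\<^sub>R w d)"
    by (simp only: coord_vector_lincomb[OF M c] tangent_vector_eq_coord_vector[OF c v, symmetric]
        tangent_vector_eq_coord_vector[OF c w, symmetric])
  thus ?thesis
    using coord_vector_in_tangent_space[OF M c, of "s *\<^sub>R v c + t *\<^sub>R w c"] by (simp only:)
qed

text \<open>Differentiability at a point, tested in every chart around it.\<close>

definition differentiable_at_point ::
    "('a, 'e::euclidean_space) chart set \<Rightarrow> ('a \<Rightarrow> real) \<Rightarrow> 'a \<Rightarrow> bool" where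
  "differentiable_at_point A f p \<longleftrightarrow>
     (\<forall>c\<in>charts_at A p. (f \<circ> chart_inv c) differentiable (at (snd c p)))"

lemma Ck_function_differentiable_at_point:
  assumes "smooth_manifold M A" and "Ck_function (Suc k) A f"
  shows "differentiable_at_point A f p"
  unfolding differentiable_at_point_def
proof
  fix c assume "c \<in> charts_at A p"
  thus "(f \<circ> chart_inv c) differentiable (at (snd c p))"
    using assms open_chart_range[OF assms(1)]
    by (intro Ck_on_Suc_differentiable_at[of k _ "snd c ` fst c"])
       (auto simp: Ck_function_def charts_at_def)
qed

lemma differential_in_chart:
  assumes M: "smooth_manifold M A" and f: "differentiable_at_point A f p"
    and c: "c \<in> charts_at A p" and v: "v \<in> tangent_space A p"
  shows "differential A f p v = frechet_derivative (f \<circ> chart_inv c) (at (snd c p)) (v c)"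
proof -
  define d where "d = (SOME d. d \<in> charts_at A p)"
  have d: "d \<in> charts_at A p" unfolding d_def using c by (rule someI)
  have "v c = frechet_derivative (transition d c) (at (snd d p)) (v d)"
    using c d v unfolding tangent_space_def by blast
  moreover have "differential A f p v = frechet_derivative (f \<circ> chart_inv d) (at (snd d p)) (v d)"
    by (simp add: differential_def d_def Let_def)
  moreover have "frechet_derivative (f \<circ> chart_inv d) (at (snd d p)) (v d) =
    frechet_derivative (f \<circ> chart_inv c) (at (snd c p))
      (frechet_derivative (transition d c) (at (snd d p)) (v d))"
  proof (rule frechet_derivative_change_chart[OF M])
    show "(f \<circ> chart_inv c) differentiable (at (snd c p))"
      using f c unfolding differentiable_at_point_def by blast
  qed (use c d in \<open>auto simp: charts_at_def\<close>)
  ultimately show ?thesis by (simp only:)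
qed

text \<open>The differential at a point of the manifold depends only on values on the manifold,
  although the functions are total on the ambient type.\<close>

lemma differential_cong:
  assumes M: "smooth_manifold M A" and p: "p \<in> topspace M"
    and f: "differentiable_at_point A f p" and eq: "\<And>q. q \<in> topspace M \<Longrightarrow> f q = f' q"
  shows "differentiable_at_point A f' p" and "differential A f' p = differential A f p"
proof -
  have *: "((f' \<circ> chart_inv c) has_derivative
      frechet_derivative (f \<circ> chart_inv c) (at (snd c p))) (at (snd c p))"
    if c: "c \<in> charts_at A p" for c
  proof (rule has_derivative_transform_within_open)
    have cA: "c \<in> A" using c by (simp add: charts_at_def)
    show "((f \<circ> chart_inv c) has_derivative
      frechet_derivative (f \<circ> chart_inv c) (at (snd c p))) (at (snd c p))"
      using f c by (simp add: differentiable_at_point_def frechet_derivative_works)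
    show "open (snd c ` fst c)" using cA by (rule open_chart_range[OF M])
    show "snd c p \<in> snd c ` fst c" using c by (simp add: charts_at_def)
    fix x assume "x \<in> snd c ` fst c"
    then obtain q where q: "q \<in> fst c" "x = snd c q" by blast
    have "q \<in> topspace M" using q cA M by (auto simp: smooth_manifold_def)
    thus "(f \<circ> chart_inv c) x = (f' \<circ> chart_inv c) x"
      by (simp add: q chart_inv_chart[OF M cA] eq)
  qed
  thus "differentiable_at_point A f' p"
    by (auto simp: differentiable_at_point_def differentiable_def)
  have "(SOME c. c \<in> charts_at A p) \<in> charts_at A p"
    using charts_at_nonempty[OF M p] by (rule someI_ex)
  from frechet_derivative_at[OF *[OF this], symmetric]
  show "differential A f' p = differential A f p"
    unfolding differential_def Let_def by (simp only:)
qed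

lemma differential_mult:
  assumes M: "smooth_manifold M A" and p: "p \<in> topspace M" and v: "v \<in> tangent_space A p"
    and f: "differentiable_at_point A f p" and h: "differentiable_at_point A h p"
  shows "differentiable_at_point A (\<lambda>q. f q * h q) p"
    and "differential A (\<lambda>q. f q * h q) p v =
      f p * differential A h p v + differential A f p v * h p"
proof -
  have *: "((\<lambda>q. f q * h q) \<circ> chart_inv c has_derivative (\<lambda>a.
       f p * frechet_derivative (h \<circ> chart_inv c) (at (snd c p)) a +
       frechet_derivative (f \<circ> chart_inv c) (at (snd c p)) a * h p)) (at (snd c p))"
    if c: "c \<in> charts_at A p" for c
  proof -
    have "chart_inv c (snd c p) = p"
      using c chart_inv_chart[OF M] by (auto simp: charts_at_def)
    moreover have "((f \<circ> chart_inv c) has_derivative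
        frechet_derivative (f \<circ> chart_inv c) (at (snd c p))) (at (snd c p))"
      "((h \<circ> chart_inv c) has_derivative
        frechet_derivative (h \<circ> chart_inv c) (at (snd c p))) (at (snd c p))"
      using f h c by (simp_all add: differentiable_at_point_def frechet_derivative_works)
    ultimately show ?thesis
      using has_derivative_mult[of "f \<circ> chart_inv c" _ "snd c p" UNIV "h \<circ> chart_inv c"]
      by (simp add: o_def)
  qed
  thus fh: "differentiable_at_point A (\<lambda>q. f q * h q) p"
    by (auto simp: differentiable_at_point_def differentiable_def)
  obtain c where c: "c \<in> charts_at A p" using charts_at_nonempty[OF M p] by blast
  show "differential A (\<lambda>q. f q * h q) p v =
      f p * differential A h p v + differential A f p v * h p"
    unfolding differential_in_chart[OF M fh c v] differential_in_chart[OF M f c v]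
      differential_in_chart[OF M h c v]
    using fun_cong[OF frechet_derivative_at[OF *[OF c]], of "v c"] by (rule sym)
qed

section \<open>The gradient\<close>

lemma inner_product_at_scale:
  assumes "inner_product_at A g p" and "v \<in> tangent_space A p" and "w \<in> tangent_space A p"
  shows "g p (\<lambda>c. s *\<^sub>R v c) w = s * g p v w"
proof -
  have "g p (\<lambda>c. s *\<^sub>R v c + 0 *\<^sub>R v c) w = s * g p v w + 0 * g p v w"
    using assms unfolding inner_product_at_def by blast
  thus ?thesis by simp
qed

lemma inner_product_at_nonneg:
  assumes "inner_product_at A g p" and v: "v \<in> tangent_space A p"
  shows "g p v v \<ge> 0"
proof (cases "v = (\<lambda>c. 0)")
  case True
  have "g p (\<lambda>c. 0 *\<^sub>R v c) v = 0 * g p v v"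
    by (rule inner_product_at_scale[OF assms(1) v v])
  thus ?thesis using True by simp
next
  case False
  hence "g p v v > 0" using assms by (simp add: inner_product_at_def)
  thus ?thesis by simp
qed

lemma metric_norm_square:
  assumes "inner_product_at A g p" and "v \<in> tangent_space A p"
  shows "(metric_norm g p v)\<^sup>2 = g p v v"
  using inner_product_at_nonneg[OF assms] by (simp add: metric_norm_def)

lemma grad_eqI:
  assumes M: "smooth_manifold M A" and p: "p \<in> topspace M" and g: "inner_product_at A g p"
    and v: "v \<in> tangent_space A p"
    and gv: "\<And>w. w \<in> tangent_space A p \<Longrightarrow> g p v w = differential A f p w"
  shows "grad A g f p = v"
  unfolding grad_def
proof (rule the_equality)
  fix v' assume v': "v' \<in> tangent_space A p \<and>
    (\<forall>w\<in>tangent_space A p. g p v' w = differential A f p w)"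
  define d where "d = (\<lambda>c. 1 *\<^sub>R v' c + (-1) *\<^sub>R v c)"
  have d: "d \<in> tangent_space A p"
    unfolding d_def using v v' by (intro tangent_space_lincomb[OF M p]) auto
  have "g p d d = 1 * g p v' d + (-1) * g p v d"
    using g v v' d unfolding inner_product_at_def d_def by blast
  also have "g p v' d = g p v d" using v' gv[OF d] d by metis
  finally have "\<not> g p d d > 0" by simp
  hence "d = (\<lambda>c. 0)" using g d unfolding inner_product_at_def by blast
  thus "v' = v" by (auto simp: d_def fun_eq_iff)
qed (use v gv in blast)

text \<open>The metric in coordinates: the inner product on the model space that corresponds to \<open>g\<close>
  at the point with coordinates \<open>x\<close> in the chart \<open>c\<close>.\<close>

definition metric_in_chart ::
    "('a, 'e::euclidean_space) chart set \<Rightarrow> ('a, 'e) metric_tensor \<Rightarrow> ('a, 'e) chart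
       \<Rightarrow> 'e \<Rightarrow> 'e \<Rightarrow> 'e \<Rightarrow> real" where
  "metric_in_chart A g c x a b =
     g (chart_inv c x) (coord_vector A c a (chart_inv c x)) (coord_vector A c b (chart_inv c x))"

lemma metric_in_chart_inner_product:
  assumes M: "smooth_manifold M A" and c: "c \<in> charts_at A p" and g: "inner_product_at A g p"
  shows "bilinear (metric_in_chart A g c (snd c p))"
    and "metric_in_chart A g c (snd c p) a b = metric_in_chart A g c (snd c p) b a"
    and "a \<noteq> 0 \<Longrightarrow> metric_in_chart A g c (snd c p) a a > 0"
proof -
  let ?v = "\<lambda>a. coord_vector A c a p"
  have G: "metric_in_chart A g c (snd c p) a b = g p (?v a) (?v b)" for a b
    using c chart_inv_chart[OF M] by (auto simp: charts_at_def metric_in_chart_def)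
  have v: "?v a \<in> tangent_space A p" for a using coord_vector_in_tangent_space[OF M c] .
  have sym: "g p (?v a) (?v b) = g p (?v b) (?v a)" for a b
    using g v unfolding inner_product_at_def by blast
  have lin: "g p (?v (s *\<^sub>R a + t *\<^sub>R a')) (?v b) = s * g p (?v a) (?v b) + t * g p (?v a') (?v b)"
    for s t a a' b
    unfolding coord_vector_lincomb[OF M c] using g v unfolding inner_product_at_def by blast
  have left: "linear (\<lambda>a. g p (?v a) (?v b))" for b
  proof (rule linearI)
    show "g p (?v (a + a')) (?v b) = g p (?v a) (?v b) + g p (?v a') (?v b)" for a a'
      using lin[of 1 a 1 a' b] by simp
    show "g p (?v (s *\<^sub>R a)) (?v b) = s *\<^sub>R g p (?v a) (?v b)" for s a
      using lin[of s a 0 a b] by simp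
  qed
  moreover have "linear (\<lambda>b. g p (?v a) (?v b))" for a
    using left[of a] by (simp add: sym[of a])
  ultimately show "bilinear (metric_in_chart A g c (snd c p))"
    by (simp add: bilinear_def G)
  show "metric_in_chart A g c (snd c p) a b = metric_in_chart A g c (snd c p) b a"
    by (simp add: G sym)
  assume "a \<noteq> 0"
  hence "?v a \<noteq> (\<lambda>c. 0)" using coord_vector_self[OF M c, of a] by auto
  thus "metric_in_chart A g c (snd c p) a a > 0"
    using g v by (simp add: G inner_product_at_def)
qed

lemma grad_properties:
  assumes M: "smooth_manifold M A" and p: "p \<in> topspace M" and g: "inner_product_at A g p"
    and f: "differentiable_at_point A f p"
  shows "grad A g f p \<in> tangent_space A p"
    and "\<And>w. w \<in> tangent_space A p \<Longrightarrow> g p (grad A g f p) w = differential A f p w"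
proof -
  obtain c where c: "c \<in> charts_at A p" using charts_at_nonempty[OF M p] by blast
  let ?D = "frechet_derivative (f \<circ> chart_inv c) (at (snd c p))"
  have "linear ?D"
    using f c by (intro linear_frechet_derivative) (auto simp: differentiable_at_point_def)
  with metric_in_chart_inner_product[OF M c g]
  obtain z where z: "\<And>b. metric_in_chart A g c (snd c p) z b = ?D b"
    using inner_product_riesz[of "metric_in_chart A g c (snd c p)" ?D] by blast
  define v where "v = coord_vector A c z p"
  have v: "v \<in> tangent_space A p"
    unfolding v_def by (rule coord_vector_in_tangent_space[OF M c])
  have gv: "g p v w = differential A f p w" if w: "w \<in> tangent_space A p" for w
  proof -
    have "g p v w = metric_in_chart A g c (snd c p) z (w c)"
      using c chart_inv_chart[OF M, of c p] tangent_vector_eq_coord_vector[OF c w]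
      by (simp add: metric_in_chart_def v_def charts_at_def)
    thus ?thesis by (simp add: z differential_in_chart[OF M f c w])
  qed
  have "grad A g f p = v" using M p g v gv by (rule grad_eqI)
  thus "grad A g f p \<in> tangent_space A p"
    and "\<And>w. w \<in> tangent_space A p \<Longrightarrow> g p (grad A g f p) w = differential A f p w"
    using v gv by auto
qed

lemma grad_norm_square_differentiable:
  assumes R: "riemannian_manifold M A g" and u: "Ck_function 2 A u"
  shows "differentiable_at_point A (\<lambda>q. (metric_norm g q (grad A g u q))\<^sup>2) p"
  unfolding differentiable_at_point_def
proof
  have M: "smooth_manifold M A" using R by (simp add: riemannian_manifold_def)
  fix c assume c: "c \<in> charts_at A p"
  hence cA: "c \<in> A" and pc: "p \<in> fst c" by (auto simp: charts_at_def)
  define U where "U = snd c ` fst c"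
  have U: "open U" and pU: "snd c p \<in> U"
    using open_chart_range[OF M cA] pc by (auto simp: U_def)
  let ?h = "\<lambda>q. (metric_norm g q (grad A g u q))\<^sup>2"
  let ?G = "metric_in_chart A g c"
  let ?\<phi> = "\<lambda>x b. frechet_derivative (u \<circ> chart_inv c) (at x) b"
  define w where "w x = grad A g u (chart_inv c x) c" for x
  have point: "\<exists>q. x = snd c q \<and> chart_inv c x = q \<and> c \<in> charts_at A q \<and> q \<in> topspace M
      \<and> inner_product_at A g q" if x: "x \<in> U" for x
  proof -
    obtain q where q: "q \<in> fst c" "x = snd c q" using x unfolding U_def by blast
    moreover have "q \<in> topspace M" using q cA M by (auto simp: smooth_manifold_def)
    ultimately show ?thesis
      using cA chart_inv_chart[OF M cA] R by (auto simp: charts_at_def riemannian_manifold_def)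
  qed
  have ud: "differentiable_at_point A u q" for q
    using Ck_function_differentiable_at_point[OF M, of 1 u] u by (simp add: numeral_2_eq_2)
  have bil: "bilinear (?G x)" and sym: "?G x a b = ?G x b a"
    and pos: "a \<noteq> 0 \<Longrightarrow> ?G x a a > 0" if x: "x \<in> U" for x a b
    using point[OF x] metric_in_chart_inner_product[OF M] by blast+
  have w_grad: "?G x (w x) b = ?\<phi> x b" and h: "(?h \<circ> chart_inv c) x = ?G x (w x) (w x)"
    if x: "x \<in> U" for x b
  proof -
    obtain q where q: "x = snd c q" "chart_inv c x = q" and cq: "c \<in> charts_at A q"
      and qM: "q \<in> topspace M" and gq: "inner_product_at A g q" using point[OF x] by blast
    note grad = grad_properties[OF M qM gq ud]
    have wq: "coord_vector A c (w x) q = grad A g u q"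
      using tangent_vector_eq_coord_vector[OF cq grad(1)] by (simp add: w_def q(2))
    have "?G x (w x) b = differential A u q (coord_vector A c b q)"
      using grad(2)[OF coord_vector_in_tangent_space[OF M cq]]
      by (simp add: metric_in_chart_def q(2) wq)
    thus "?G x (w x) b = ?\<phi> x b"
      by (simp add: differential_in_chart[OF M ud cq coord_vector_in_tangent_space[OF M cq]]
          coord_vector_self[OF M cq] q(1))
    show "(?h \<circ> chart_inv c) x = ?G x (w x) (w x)"
      using metric_norm_square[OF gq grad(1)] by (simp add: metric_in_chart_def q(2) wq)
  qed
  have Gd: "(\<lambda>x. ?G x a b) differentiable (at (snd c p))" for a b
    using R cA U pU unfolding metric_in_chart_def U_def
    by (intro smooth_on_differentiable_at[of _ "snd c ` fst c"])
       (auto simp: riemannian_manifold_def)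
  have "Ck_on (Suc (Suc 0)) (u \<circ> chart_inv c) U"
    using u cA by (simp add: Ck_function_def U_def numeral_2_eq_2)
  hence "Ck_on (Suc 0) (\<lambda>x. ?\<phi> x b) U" for b by (simp only: Ck_on.simps(2)) blast
  hence \<phi>d: "(\<lambda>x. ?\<phi> x b) differentiable (at (snd c p))" for b
    using U pU by (rule Ck_on_Suc_differentiable_at)
  have "(\<lambda>x. ?G x (w x) (w x)) differentiable (at (snd c p))"
    using U pU bil sym pos[OF pU] Gd \<phi>d w_grad by (rule dual_norm_differentiable)
  then obtain D where "((\<lambda>x. ?G x (w x) (w x)) has_derivative D) (at (snd c p))"
    by (auto simp: differentiable_def)
  hence "((?h \<circ> chart_inv c) has_derivative D) (at (snd c p))"
    using U pU by (rule has_derivative_transform_within_open) (simp only: h)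
  thus "(?h \<circ> chart_inv c) differentiable (at (snd c p))" by (rule differentiableI)
qed

section \<open>Conformal change of the metric\<close>

lemma conformal_metric_inner_product_at:
  assumes "inner_product_at A g p" and "F p > 0"
  shows "inner_product_at A (conformal_metric F g) p"
  using assms unfolding inner_product_at_def conformal_metric_def
  by (simp add: distrib_left mult.left_commute)

lemma grad_conformal_metric:
  assumes M: "smooth_manifold M A" and p: "p \<in> topspace M" and g: "inner_product_at A g p"
    and f: "differentiable_at_point A f p" and F: "F p > 0"
  shows "grad A (conformal_metric F g) f p = (\<lambda>c. (F p)\<^sup>2 *\<^sub>R grad A g f p c)"
proof (rule grad_eqI[OF M p conformal_metric_inner_product_at[where F = F, OF g F]])
  note grad = grad_properties[OF M p g f]
  show "(\<lambda>c. (F p)\<^sup>2 *\<^sub>R grad A g f p c) \<in> tangent_space A p"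
    using tangent_space_lincomb[OF M p grad(1) grad(1), of "(F p)\<^sup>2" 0] by simp
  fix w assume w: "w \<in> tangent_space A p"
  have "g p (\<lambda>c. (F p)\<^sup>2 *\<^sub>R grad A g f p c) w = (F p)\<^sup>2 * g p (grad A g f p) w"
    by (rule inner_product_at_scale[OF g grad(1) w])
  thus "conformal_metric F g p (\<lambda>c. (F p)\<^sup>2 *\<^sub>R grad A g f p c) w = differential A f p w"
    using F grad(2)[OF w] by (simp add: conformal_metric_def power_int_minus field_simps)
qed

text \<open>The defining expression \<open>g(\<nabla>u, \<nabla>h)\<close> is the derivative of \<open>h\<close> along \<open>\<nabla>u\<close>.\<close>

lemma infinity_laplacian_eq_differential:
  assumes M: "smooth_manifold M A" and p: "p \<in> topspace M" and g: "inner_product_at A g p"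
    and u: "differentiable_at_point A u p"
    and h: "differentiable_at_point A (\<lambda>q. (metric_norm g q (grad A g u q))\<^sup>2) p"
  shows "infinity_laplacian A g u p =
    1 / 2 * differential A (\<lambda>q. (metric_norm g q (grad A g u q))\<^sup>2) p (grad A g u p)"
proof -
  note gu = grad_properties[OF M p g u] and gh = grad_properties[OF M p g h]
  let ?h = "\<lambda>q. (metric_norm g q (grad A g u q))\<^sup>2"
  have "g p (grad A g u p) (grad A g ?h p) = g p (grad A g ?h p) (grad A g u p)"
    using g gu(1) gh(1) unfolding inner_product_at_def by blast
  thus ?thesis unfolding infinity_laplacian_def gh(2)[OF gu(1)] by (rule arg_cong)
qed

theorem theorem6p1:
  fixes M :: "'a topology"
    and A :: "('a, 'e::euclidean_space) chart set"
    and g :: "('a, 'e) metric_tensor"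
    and F u :: "'a \<Rightarrow> real"
  assumes "riemannian_manifold M A g"
    and "smooth_function A F"
    and "\<And>p. p \<in> topspace M \<Longrightarrow> F p > 0"
    and "Ck_function 2 A u"
    and "p \<in> topspace M"
  shows "infinity_laplacian A (conformal_metric F g) u p =
      F p ^ 4 * infinity_laplacian A g u p
      + F p ^ 3 * (metric_norm g p (grad A g u p))\<^sup>2 * g p (grad A g u p) (grad A g F p)"
proof -
  let ?g' = "conformal_metric F g"
  define h where "h = (\<lambda>q. (metric_norm g q (grad A g u q))\<^sup>2)"
  define h' where "h' = (\<lambda>q. (metric_norm ?g' q (grad A ?g' u q))\<^sup>2)"
  note p = \<open>p \<in> topspace M\<close>
  have M: "smooth_manifold M A" and g: "\<And>q. q \<in> topspace M \<Longrightarrow> inner_product_at A g q"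
    using assms(1) by (auto simp: riemannian_manifold_def)
  have g': "inner_product_at A ?g' q" if "q \<in> topspace M" for q
    using that by (intro conformal_metric_inner_product_at g assms(3))
  have u: "differentiable_at_point A u q" for q
    using Ck_function_differentiable_at_point[OF M, of 1 u] assms(4) by (simp add: numeral_2_eq_2)
  have F: "differentiable_at_point A F p"
    using Ck_function_differentiable_at_point[OF M] assms(2) unfolding smooth_function_def by blast
  have hd: "differentiable_at_point A h p"
    unfolding h_def by (rule grad_norm_square_differentiable[OF assms(1,4)])
  \<comment> \<open>The squared gradient norm scales by \<open>F\<^sup>2\<close>, written as two factors for the product rule.\<close>
  have h'_eq: "F q * (F q * h q) = h' q" if q: "q \<in> topspace M" for q
  proof -
    note gu = grad_properties[OF M q g[OF q] u] and gu' = grad_properties[OF M q g'[OF q] u]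
    note gc = grad_conformal_metric[where F = F, OF M q g[OF q] u assms(3)[OF q]]
    have "h' q = differential A u q (grad A ?g' u q)"
      unfolding h'_def using metric_norm_square[OF g'[OF q] gu'(1)] gu' by simp
    also have "\<dots> = g q (grad A g u q) (grad A ?g' u q)"
      using gu gu' by simp
    also have "\<dots> = g q (grad A ?g' u q) (grad A g u q)"
      using g[OF q] gu(1) gu'(1) by (simp add: inner_product_at_def)
    also have "\<dots> = (F q)\<^sup>2 * h q"
      unfolding gc h_def
      using metric_norm_square[OF g[OF q] gu(1)] inner_product_at_scale[OF g[OF q] gu(1) gu(1)]
      by simp
    finally show ?thesis by (simp add: power2_eq_square)
  qed
  note gu = grad_properties[OF M p g[OF p] u] and gF = grad_properties[OF M p g[OF p] F]
  let ?v = "grad A g u p"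
  have Fh: "differentiable_at_point A (\<lambda>q. F q * h q) p"
    using differential_mult(1)[OF M p gu(1) F hd] .
  note FFh = differential_mult[OF M p gu(1) F Fh]
  have cong: "differentiable_at_point A h' p"
    "differential A h' p = differential A (\<lambda>q. F q * (F q * h q)) p"
    by (rule differential_cong[OF M p FFh(1)], erule h'_eq)+
  note gh' = grad_properties[OF M p g[OF p] cong(1)]
  have sym: "g p v w = g p w v" if "v \<in> tangent_space A p" "w \<in> tangent_space A p" for v w
    using g[OF p] that by (simp add: inner_product_at_def)
  have g'u: "grad A ?g' u p \<in> tangent_space A p"
    by (rule grad_properties(1)[OF M p g'[OF p] u])
  have "infinity_laplacian A ?g' u p = 1 / 2 * differential A h' p (grad A ?g' u p)"
    using infinity_laplacian_eq_differential[OF M p g'[OF p] u] cong(1) by (simp add: h'_def)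
  also have "differential A h' p (grad A ?g' u p) = g p (grad A ?g' u p) (grad A g h' p)"
    using gh'(2)[OF g'u] sym[OF g'u gh'(1)] by (simp only:)
  also have "\<dots> = (F p)\<^sup>2 * g p ?v (grad A g h' p)"
    unfolding grad_conformal_metric[where F = F, OF M p g[OF p] u assms(3)[OF p]]
    by (rule inner_product_at_scale[OF g[OF p] gu(1) gh'(1)])
  also have "g p ?v (grad A g h' p) = differential A h' p ?v"
    using gh'(2)[OF gu(1)] sym[OF gu(1) gh'(1)] by (simp only:)
  \<comment> \<open>the product rule for \<open>F (F h)\<close>\<close>
  also have "differential A h' p ?v =
      (F p)\<^sup>2 * differential A h p ?v + 2 * F p * h p * differential A F p ?v"
    unfolding cong(2) FFh(2) differential_mult(2)[OF M p gu(1) F hd]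
    by (simp add: power2_eq_square algebra_simps)
  also have "differential A F p ?v = g p ?v (grad A g F p)"
    using gF(2)[OF gu(1)] sym[OF gu(1) gF(1)] by (simp only:)
  also have "differential A h p ?v = 2 * infinity_laplacian A g u p"
    using infinity_laplacian_eq_differential[OF M p g[OF p] u] hd by (simp add: h_def)
  finally show ?thesis
    by (simp add: h_def algebra_simps power2_eq_square power3_eq_cube power4_eq_xxxx)
qed

end
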